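(* Every tree is $132$-representable.
   Context: All graphs are finite and simple, and vertex labels are taken from a totally ordered set. For a finite word $w$, $A(w)$ is the set of letters occurring in $w$. Two distinct letters $x,y\in A(w)$ alternate in $w$ if deleting from $w$ all letters other than $x$ and $y$ leaves a word of the form $xyxy\cdots$ or $yxyx\cdots$ (of even or odd length). A word $w$ represents a graph $G=(V,E)$ if $A(w)=V$ and, for all $x\ne y$ in $V$, $x$ and $y$ alternate in $w$ if and only if $xy\in E$. A word $w=w_1\cdots w_m$ avoids the pattern $132$ (is $132$-avoiding) if there are no indices $i_1<i_2<i_3$ with $w_{i_1}<w_{i_3}<w_{i_2}$. A graph $G$ is $132$-representable if, possibly after relabelling its vertices by elements of a totally ordered set, there is a $132$-avoiding word that represents $G$. *)

theory Defs
  imports Graph_Theory.Digraph_Component Graph_Theory.Pair_Digraph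
begin

text \<open>
  A finite simple graph is a \<^locale>\<open>pair_graph\<close>: finitely many vertices and a symmetric,
  irreflexive set of vertex pairs, so an edge \<open>xy\<close> occurs as both \<open>(x, y)\<close> and \<open>(y, x)\<close>.
  Consequently every edge is a directed cycle of length 2, and the predicate
  \<^const>\<open>tree\<close> of the library holds for no such graph with an edge. The cycles of the undirected
  graph are exactly the directed cycles of length at least 3. Note that
  \<^const>\<open>Digraph_Component.connected\<close> includes that there is at least one vertex.
\<close>

definition undirected_tree :: "'a pair_pre_digraph \<Rightarrow> bool" where
  "undirected_tree G \<longleftrightarrow>
     pair_graph G \<and> Digraph_Component.connected (with_proj G) \<and>
     \<not> (\<exists>p. pre_digraph.cycle (with_proj G) p \<and> 3 \<le> length p)"

text \<open>The word \<open>xyxy\<dots>\<close> of length \<open>n\<close>.\<close>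

definition alternating_word :: "'a \<Rightarrow> 'a \<Rightarrow> nat \<Rightarrow> 'a list" where
  "alternating_word x y n = map (\<lambda>i. if even i then x else y) [0..<n]"

definition alternate :: "'a list \<Rightarrow> 'a \<Rightarrow> 'a \<Rightarrow> bool" where
  "alternate w x y \<longleftrightarrow>
     x \<in> set w \<and> y \<in> set w \<and> x \<noteq> y \<and>
     (\<exists>n. filter (\<lambda>z. z = x \<or> z = y) w = alternating_word x y n \<or>
          filter (\<lambda>z. z = x \<or> z = y) w = alternating_word y x n)"

definition represents :: "'a list \<Rightarrow> 'a pair_pre_digraph \<Rightarrow> bool" where
  "represents w G \<longleftrightarrow>
     set w = pverts G \<and>
     (\<forall>x \<in> pverts G. \<forall>y \<in> pverts G. x \<noteq> y \<longrightarrow> (alternate w x y \<longleftrightarrow> (x, y) \<in> parcs G))"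

definition avoids_132 :: "'a::linorder list \<Rightarrow> bool" where
  "avoids_132 w \<longleftrightarrow>
     \<not> (\<exists>i j k. i < j \<and> j < k \<and> k < length w \<and> w ! i < w ! k \<and> w ! k < w ! j)"

definition relabel :: "('a \<Rightarrow> 'b) \<Rightarrow> 'a pair_pre_digraph \<Rightarrow> 'b pair_pre_digraph" where
  "relabel f G = \<lparr> pverts = f ` pverts G, parcs = map_prod f f ` parcs G \<rparr>"

text \<open>
  HOL cannot quantify existentially over the totally ordered type of labels. The labels are natural
  numbers instead, which loses nothing because only finitely many labels occur:
  see \<open>representable_132I\<close> below.
\<close>

definition representable_132 :: "'a pair_pre_digraph \<Rightarrow> bool" where
  "representable_132 G \<longleftrightarrow>
     (\<exists>(f :: 'a \<Rightarrow> nat) w. inj_on f (pverts G) \<and> avoids_132 w \<and> represents w (relabel f G))"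

lemma alternate_map:
  assumes g: "inj_on g (set w)" and "x \<in> set w" "y \<in> set w"
  shows "alternate (map g w) (g x) (g y) \<longleftrightarrow> alternate w x y"
proof -
  have alt: "alternating_word (g a) (g b) n = map g (alternating_word a b n)" for a b n
    by (simp add: alternating_word_def)
  have fil: "filter (\<lambda>z. z = g x \<or> z = g y) (map g w) = map g (filter (\<lambda>z. z = x \<or> z = y) w)"
    unfolding filter_map comp_def
    by (intro arg_cong[where f = "map g"] filter_cong refl)
      (use assms in \<open>auto dest: inj_onD\<close>)
  have inj: "map g (filter (\<lambda>z. z = x \<or> z = y) w) = map g (alternating_word a b n) \<longleftrightarrow>
      filter (\<lambda>z. z = x \<or> z = y) w = alternating_word a b n"
    if "a \<in> set w" "b \<in> set w" for a b n
    by (intro inj_on_map_eq_map inj_on_subset[OF g])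
      (use that in \<open>auto simp: alternating_word_def split: if_splits\<close>)
  have "g x = g y \<longleftrightarrow> x = y" using assms by (auto dest: inj_onD)
  then show ?thesis
    unfolding alternate_def fil alt using assms by (simp add: inj)
qed

lemma relabel_arc_iff:
  assumes "pair_graph G" "inj_on h (pverts G)" "u \<in> pverts G" "v \<in> pverts G"
  shows "(h u, h v) \<in> parcs (relabel h G) \<longleftrightarrow> (u, v) \<in> parcs G"
proof -
  interpret pair_graph G by (rule assms(1))
  have "(u, v) \<in> parcs G" if "(a, b) \<in> parcs G" "h u = h a" "h v = h b" for a b
  proof -
    have "a \<in> pverts G" "b \<in> pverts G"
      using arc_fst_in_verts[OF that(1)] arc_snd_in_verts[OF that(1)] by simp_all
    then have "u = a" "v = b" using that assms inj_onD[OF assms(2)] by blast+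
    then show ?thesis using that(1) by simp
  qed
  then show ?thesis unfolding relabel_def by auto
qed

lemma representable_132I:
  fixes f :: "'a \<Rightarrow> 'b::linorder"
  assumes f: "inj_on f (pverts G)" and w: "avoids_132 w" and r: "represents w (relabel f G)"
    and G: "pair_graph G"
  shows "representable_132 G"
proof -
  define g where "g x = card {y \<in> set w. y < x}" for x
  have mono: "g x < g y" if "x \<in> set w" "x < y" for x y
    unfolding g_def using that by (intro psubset_card_mono) auto
  have less: "g x < g y \<longleftrightarrow> x < y" if "x \<in> set w" "y \<in> set w" for x y
    using mono that by (metis linorder_neqE less_asym less_irrefl)
  have inj: "inj_on g (set w)"
    using mono by (metis inj_onI linorder_neqE less_irrefl)
  have setw: "set w = f ` pverts G"
    using r by (simp add: represents_def relabel_def)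
  have injgf: "inj_on (g \<circ> f) (pverts G)"
    using f inj unfolding setw by (rule comp_inj_on)
  have av: "avoids_132 (map g w)"
    unfolding avoids_132_def
  proof clarify
    fix i j k assume ijk: "i < j" "j < k" "k < length (map g w)"
      and "map g w ! i < map g w ! k" "map g w ! k < map g w ! j"
    then have "w ! i < w ! k" "w ! k < w ! j" by (simp_all add: less)
    with w ijk show False unfolding avoids_132_def by auto
  qed
  have "represents (map g w) (relabel (g \<circ> f) G)"
    unfolding represents_def
  proof (intro conjI ballI impI)
    show "set (map g w) = pverts (relabel (g \<circ> f) G)"
      by (simp add: relabel_def setw image_comp)
    fix x y
    assume "x \<in> pverts (relabel (g \<circ> f) G)" "y \<in> pverts (relabel (g \<circ> f) G)" and ne: "x \<noteq> y"
    then obtain u v where u: "u \<in> pverts G" "x = g (f u)" and v: "v \<in> pverts G" "y = g (f v)"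
      by (auto simp: relabel_def)
    have "alternate (map g w) x y \<longleftrightarrow> alternate w (f u) (f v)"
      using u v alternate_map[OF inj] by (auto simp: setw)
    also have "\<dots> \<longleftrightarrow> (f u, f v) \<in> parcs (relabel f G)"
    proof -
      have "f u \<in> pverts (relabel f G)" "f v \<in> pverts (relabel f G)" "f u \<noteq> f v"
        using u v ne by (auto simp: relabel_def)
      then show ?thesis using r unfolding represents_def by blast
    qed
    also have "\<dots> \<longleftrightarrow> (u, v) \<in> parcs G" using relabel_arc_iff[OF G f u(1) v(1)] .
    also have "\<dots> \<longleftrightarrow> (x, y) \<in> parcs (relabel (g \<circ> f) G)"
      using relabel_arc_iff[OF G injgf u(1) v(1)] u(2) v(2) by simp
    finally show "alternate (map g w) x y \<longleftrightarrow> (x, y) \<in> parcs (relabel (g \<circ> f) G)" .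
  qed
  with injgf av show ?thesis unfolding representable_132_def by blast
qed

end

theory Submission
  imports Defs
begin

text \<open>
  A tree is built up from one vertex by adding leaves. Suppose that a word \<open>w\<close> with every letter
  occurring twice represents the part built so far, and that the next vertex \<open>s\<close> is a leaf attached
  to \<open>r\<close>. Replace the first \<open>r\<close> in \<open>w\<close> by \<open>s r s\<close>. Then \<open>s\<close> and \<open>r\<close> leave \<open>s r s r\<close>, so they
  alternate, whereas the two adjacent \<open>s\<close> rule out that \<open>s\<close> alternates with any other letter; and
  no other pair of letters is affected. So the new word represents the enlarged tree
  (\<open>alternate_sandwich\<close>).

  The label of \<open>s\<close> is chosen immediately above that of \<open>r\<close>. With this choice a pattern 132 of the
  new word becomes one of the old word when each \<open>s\<close> is read as \<open>r\<close>, except when both \<open>s\<close> and \<open>r\<close>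
  take part in it. In that case no label lies between theirs, so \<open>r\<close> and \<open>s\<close> are either the 1 and the
  3 of the pattern, for which there is no room between an \<open>r\<close> and a later \<open>s\<close>, or they are the 3 and
  the 2, and then a letter smaller than \<open>r\<close> stands before the first \<open>r\<close>. The latter is excluded by an
  invariant that the construction preserves: every letter is smaller than all letters that precede
  its first occurrence. See \<open>first_occurrences_descend_sandwich\<close> and \<open>avoids_132_sandwich\<close>.

  On the graph side, let \<open>S\<close> be a set of vertices any two of which are joined by a path inside \<open>S\<close>.
  A vertex outside \<open>S\<close> with two neighbours in \<open>S\<close> would close a cycle of length at least 3. Hence
  every vertex that is joined to \<open>S\<close> by an edge is a leaf of the subgraph induced by \<open>S\<close> and that
  vertex, and a maximal \<open>S\<close> whose induced subgraph has a word as above is the set of all vertices.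
\<close>

section \<open>Inserting a letter around a first occurrence\<close>

lemma alternating_word_no_square:
  assumes "x \<noteq> y"
  shows "alternating_word x y n \<noteq> p @ a # a # q"
proof
  let ?w = "alternating_word x y n" and ?m = "length p"
  assume eq: "?w = p @ a # a # q"
  from arg_cong[OF eq, of length] have "Suc ?m < n" by (simp add: alternating_word_def)
  then have "?w ! ?m = (if even ?m then x else y)" "?w ! Suc ?m = (if even ?m then y else x)"
    by (simp_all add: alternating_word_def)
  moreover have "?w ! ?m = a" "?w ! Suc ?m = a" by (simp_all add: eq nth_append)
  ultimately show False using assms by (simp split: if_splits)
qed

lemma alternate_commute: "alternate w x y \<longleftrightarrow> alternate w y x"
  by (auto simp: alternate_def disj_commute)

lemma alternate_if_filter_eq:
  assumes "filter (\<lambda>z. z = x \<or> z = y) w = filter (\<lambda>z. z = x \<or> z = y) w'"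
  shows "alternate w x y \<longleftrightarrow> alternate w' x y"
proof -
  have "{x, y} \<inter> set w = {x, y} \<inter> set w'" using arg_cong[OF assms, of set] by auto
  then show ?thesis unfolding alternate_def assms by blast
qed

text \<open>
  Equivalently, the labels of the distinct letters decrease when the letters are listed in the order
  of their first occurrences.
\<close>

definition first_occurrences_descend :: "('a \<Rightarrow> nat) \<Rightarrow> 'a list \<Rightarrow> bool" where
  "first_occurrences_descend f w \<longleftrightarrow>
     (\<forall>u x v. w = u @ x # v \<longrightarrow> x \<notin> set u \<longrightarrow> (\<forall>z \<in> set u. f x < f z))"

lemma inj_on_if_first_occurrences_descend:
  assumes "first_occurrences_descend f w"
  shows "inj_on f (set w)"
proof (rule inj_onI, rule ccontr)
  fix x y assume "x \<in> set w" "y \<in> set w" and eq: "f x = f y" and ne: "x \<noteq> y"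
  then obtain u v u' v' where x: "w = u @ x # v" "x \<notin> set u" and y: "w = u' @ y # v'" "y \<notin> set u'"
    by (metis split_list_first)
  from x(1) y(1) have "u @ x # v = u' @ y # v'" by simp
  then obtain us where "u = u' @ us \<and> us @ x # v = y # v' \<or> u @ us = u' \<and> x # v = us @ y # v'"
    unfolding append_eq_append_conv2 ..
  with ne have "y \<in> set u \<or> x \<in> set u'" by (cases us) auto
  with x y have "f x < f y \<or> f y < f x"
    using assms unfolding first_occurrences_descend_def by blast
  with eq show False by simp
qed

text \<open>
  Doubling the natural number labels leaves the value right above the label of \<open>r\<close> free for \<open>s\<close>.
\<close>

definition relabel_above :: "('a \<Rightarrow> nat) \<Rightarrow> 'a \<Rightarrow> 'a \<Rightarrow> 'a \<Rightarrow> nat" where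
  "relabel_above f r s = (\<lambda>x. 2 * f x)(s := Suc (2 * f r))"

text \<open>
  In the new word the first \<open>s\<close> stands immediately before the first \<open>r\<close> and is only just larger. So
  \<open>s\<close> is below everything that \<open>r\<close> was below, and a letter that was below \<open>r\<close> is below \<open>s\<close>.
\<close>

lemma first_occurrences_descend_sandwich:
  assumes d: "first_occurrences_descend f (u @ r # v)"
    and r: "r \<notin> set u" and s: "s \<notin> set (u @ r # v)"
  shows "first_occurrences_descend (relabel_above f r s) (u @ s # r # s # v)"
  unfolding first_occurrences_descend_def
proof (intro allI impI ballI)
  fix p x q z assume eq: "u @ s # r # s # v = p @ x # q" and x: "x \<notin> set p" and z: "z \<in> set p"
  have d: "f b < f c" if "u @ r # v = a @ b # e" "b \<notin> set a" "c \<in> set a" for a b c e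
    using d that unfolding first_occurrences_descend_def by blast
  from eq consider us where "u = p @ x # us" | "p = u" "x = s" | "p = u @ [s]" "x = r"
    | "p = u @ [s, r]" "x = s" | v1 where "p = u @ s # r # s # v1" "v = v1 @ x # q"
    by (auto simp: append_eq_append_conv2 Cons_eq_append_conv append_eq_Cons_conv)
  then show "relabel_above f r s x < relabel_above f r s z"
  proof cases
    case 1
    with d[of p x "us @ r # v" z] x z s show ?thesis by (auto simp: relabel_above_def)
  next
    case 2
    with d[of u r v z] z r s show ?thesis by (auto simp: relabel_above_def)
  next
    case 3
    with d[of u r v z] z r s show ?thesis by (auto simp: relabel_above_def)
  next
    case 4
    with x show ?thesis by simp
  next
    case 5
    with x have nx: "x \<notin> set (u @ r # v1)" by auto
    then have *: "f x < f c" if "c \<in> set (u @ r # v1)" for c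
      using d[of "u @ r # v1" x q c] 5 that by simp
    from 5 s have "x \<noteq> s" by auto
    show ?thesis
    proof (cases "z = s")
      case True
      with *[of r] \<open>x \<noteq> s\<close> show ?thesis by (simp add: relabel_above_def)
    next
      case False
      with *[of z] \<open>x \<noteq> s\<close> z 5 show ?thesis by (auto simp: relabel_above_def)
    qed
  qed
qed

text \<open>
  The positions of the new word are mapped onto those of the old word by contracting the block
  \<open>s r s\<close> to the position of \<open>r\<close>. This sends a pattern 132 to a pattern 132 unless the labels of two
  of its entries, or the positions of two neighbouring entries, become equal. As the label of \<open>s\<close> is
  the successor of that of \<open>r\<close>, equal labels mean that the entries are \<open>r\<close> and \<open>s\<close>: as 1 and 3 they
  would have to lie in the block with an entry between them, but an \<open>r\<close> is followed there by \<open>s\<close>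
  directly; as 3 and 2 they would be preceded by a letter smaller than \<open>r\<close> before the block.
\<close>

lemma avoids_132_sandwich:
  assumes d: "first_occurrences_descend f (u @ r # v)" and av: "avoids_132 (map f (u @ r # v))"
    and r: "r \<notin> set u" and s: "s \<notin> set (u @ r # v)"
  shows "avoids_132 (map (relabel_above f r s) (u @ s # r # s # v))"
  unfolding avoids_132_def
proof clarify
  let ?old = "u @ r # v" and ?new = "u @ s # r # s # v" and ?g = "relabel_above f r s"
  define n where "n = length u"
  define \<phi> where "\<phi> i = (if i < n then i else if i \<le> n + 2 then n else i - 2)" for i
  \<comment> \<open>The old label of the letter in position \<open>i\<close>, where \<open>s\<close> counts as \<open>r\<close>.\<close>
  define h where "h i = f (?old ! \<phi> i)" for i
  fix i j k assume ijk: "i < j" "j < k" "k < length (map ?g ?new)"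
    and less: "map ?g ?new ! i < map ?g ?new ! k" "map ?g ?new ! k < map ?g ?new ! j"
  have label: "map ?g ?new ! m = 2 * h m + of_bool (m = n \<or> m = n + 2)"
    if "m < length ?new" for m
  proof -
    consider "m < n" | "m = n" | "m = n + 1" | "m = n + 2" | a where "m = n + 3 + a"
    proof (cases "n + 3 \<le> m")
      case True
      with that(5) show ?thesis using le_Suc_ex by blast
    next
      case False
      with that(1-4) show ?thesis by linarith
    qed
    then show ?thesis
    proof cases
      case 1
      then have "u ! m \<noteq> s" using s by (auto simp: n_def)
      with 1 show ?thesis by (simp add: h_def \<phi>_def n_def nth_append relabel_above_def)
    next
      case (5 a)
      have "a < length v" using 5 that by (simp add: n_def)
      have "v ! a \<noteq> s" using s \<open>a < length v\<close> by auto
      with 5 \<open>a < length v\<close> show ?thesis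
        by (simp add: h_def \<phi>_def n_def nth_append relabel_above_def numeral_3_eq_3)
    qed (use s in \<open>auto simp: h_def \<phi>_def n_def nth_append relabel_above_def\<close>)
  qed
  have before: "f r < h m" if "m < n" for m
  proof -
    have "u ! m \<in> set u" using that by (simp add: n_def)
    then have "f r < f (u ! m)" using d r unfolding first_occurrences_descend_def by blast
    with that show ?thesis by (simp add: h_def \<phi>_def n_def nth_append)
  qed
  have block: "h m = f r" if "n \<le> m" "m \<le> n + 2" for m
    using that by (auto simp: h_def \<phi>_def n_def)
  have less': "2 * h i + of_bool (i = n \<or> i = n + 2) < 2 * h k + of_bool (k = n \<or> k = n + 2)"
    "2 * h k + of_bool (k = n \<or> k = n + 2) < 2 * h j + of_bool (j = n \<or> j = n + 2)"
    using less label[of i] label[of j] label[of k] ijk by simp_all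
  \<comment> \<open>Equality would make the entries in roles 1 and 3 an \<open>r\<close> and a later \<open>s\<close> of the block. The
    entry in role 1 cannot precede the block, because \<open>r\<close> is below everything there. So no entry fits in between.\<close>
  have ik: "h i < h k"
  proof (rule ccontr)
    assume "\<not> h i < h k"
    with less' have eq: "h i = h k" and k: "k = n \<or> k = n + 2" and i: "i \<noteq> n"
      by (auto simp: of_bool_def split: if_splits)
    from k block have "h i = f r" unfolding eq by auto
    with before[of i] i have "n + 1 \<le> i" by (cases "i < n") auto
    with k ijk show False by auto
  qed
  \<comment> \<open>Equality would make the entry in role 2 an \<open>s\<close>, with a letter smaller than \<open>r\<close> before
    the block.\<close>
  have kj: "h k < h j"
  proof (rule ccontr)
    assume "\<not> h k < h j"
    with less' have eq: "h k = h j" and j: "j = n \<or> j = n + 2"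
      by (auto simp: of_bool_def split: if_splits)
    from j block have "h j = f r" by auto
    with ik eq have "h i < f r" by simp
    with before[of i] block[of i] j ijk show False by (cases "i < n") auto
  qed
  have "\<phi> i < \<phi> j"
  proof (rule ccontr)
    assume "\<not> \<phi> i < \<phi> j"
    with ijk have "\<phi> i = \<phi> j" by (auto simp: \<phi>_def split: if_splits)
    then have "h i = h j" by (simp add: h_def)
    with ik kj show False by simp
  qed
  moreover have "\<phi> j < \<phi> k"
  proof (rule ccontr)
    assume "\<not> \<phi> j < \<phi> k"
    with ijk have "\<phi> j = \<phi> k" by (auto simp: \<phi>_def split: if_splits)
    then have "h j = h k" by (simp add: h_def)
    with kj show False by simp
  qed
  moreover have k: "\<phi> k < length (map f ?old)" using ijk by (auto simp: \<phi>_def n_def)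
  moreover have "map f ?old ! \<phi> i < map f ?old ! \<phi> k" "map f ?old ! \<phi> k < map f ?old ! \<phi> j"
    using ik kj nth_map[of _ ?old f] calculation by (simp_all only: h_def length_map)
  ultimately show False using av unfolding avoids_132_def by blast
qed

text \<open>
  Every letter of the words considered here occurs twice, so one \<open>r\<close> follows the block \<open>s r s\<close>; with
  more of them, \<open>s r s r r\<close> would spoil the alternation of \<open>s\<close> and \<open>r\<close>. Every other letter fails to
  separate the two \<open>s\<close>.
\<close>

lemma alternate_sandwich:
  assumes r: "r \<notin> set u" "count_list v r = 1" and s: "s \<notin> set (u @ r # v)"
    and z: "z \<in> set (u @ r # v)"
  shows "alternate (u @ s # r # s # v) s z \<longleftrightarrow> z = r"
proof (cases "z = r")
  case True
  have "filter (\<lambda>x. x = s \<or> x = r) u = []" using r(1) s by (auto simp: filter_empty_conv)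
  moreover have "filter (\<lambda>x. x = s \<or> x = r) v = filter ((=) r) v"
    using s by (intro filter_cong) auto
  moreover have "\<dots> = [r]"
    using r(2) replicate_length_filter[of r v] by (simp add: count_list_eq_length_filter)
  ultimately have "filter (\<lambda>x. x = s \<or> x = r) (u @ s # r # s # v) = alternating_word s r 4"
    by (simp add: alternating_word_def upt_rec)
  then show ?thesis using True s unfolding alternate_def by auto
next
  case False
  let ?F = "filter (\<lambda>x. x = s \<or> x = z)"
  have "?F (u @ s # r # s # v) = ?F u @ s # s # ?F v" using False s by auto
  then show ?thesis
    using False alternating_word_no_square unfolding alternate_def by metis
qed

section \<open>Adding a leaf to a represented graph\<close>

text \<open>
  The letters are the vertices themselves. The labels \<open>f\<close> are kept apart from the word, so that they
  can change from one leaf to the next while the represented graph stays the same.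
\<close>

definition tree_word :: "('a \<Rightarrow> nat) \<Rightarrow> 'a list \<Rightarrow> 'a pair_pre_digraph \<Rightarrow> bool" where
  "tree_word f w G \<longleftrightarrow> represents w G \<and> (\<forall>x \<in> set w. count_list w x = 2) \<and>
     first_occurrences_descend f w \<and> avoids_132 (map f w)"

lemma tree_word_add_leaf:
  assumes w: "tree_word f w G" and G: "parcs G \<subseteq> pverts G \<times> pverts G"
    and r: "r \<in> pverts G" and s: "s \<notin> pverts G"
  shows "\<exists>f' w'. tree_word f' w'
    \<lparr>pverts = insert s (pverts G), parcs = parcs G \<union> {(r, s), (s, r)}\<rparr>"
proof -
  have rep: "represents w G" and cnt: "\<And>x. x \<in> set w \<Longrightarrow> count_list w x = 2"
    and desc: "first_occurrences_descend f w" and av: "avoids_132 (map f w)"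
    using w by (auto simp: tree_word_def)
  have setw: "set w = pverts G" using rep by (simp add: represents_def)
  from r setw obtain u v where uv: "w = u @ r # v" "r \<notin> set u" by (metis split_list_first)
  have s': "s \<notin> set (u @ r # v)" using s setw uv by simp
  let ?w = "u @ s # r # s # v"
  let ?G = "\<lparr>pverts = insert s (pverts G), parcs = parcs G \<union> {(r, s), (s, r)}\<rparr>"
  have cv: "count_list v r = 1" using cnt[of r] uv by (simp add: count_list_0_iff)
  have alt_s: "alternate ?w s z \<longleftrightarrow> z = r" if "z \<in> pverts G" for z
    using alternate_sandwich[OF uv(2) cv s'] that setw uv by blast
  have alt_old: "alternate ?w x y \<longleftrightarrow> alternate w x y" if "x \<noteq> s" "y \<noteq> s" for x y
    using that by (intro alternate_if_filter_eq) (auto simp: uv)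
  have "represents ?w ?G"
    unfolding represents_def
  proof (intro conjI ballI impI)
    show "set ?w = pverts ?G" using setw uv by auto
    fix x y assume xy: "x \<in> pverts ?G" "y \<in> pverts ?G" "x \<noteq> y"
    consider "x = s" "y \<in> pverts G" | "y = s" "x \<in> pverts G" | "x \<in> pverts G" "y \<in> pverts G"
      using xy by auto
    then show "alternate ?w x y \<longleftrightarrow> (x, y) \<in> parcs ?G"
    proof cases
      case 1
      with alt_s[of y] s G show ?thesis by auto
    next
      case 2
      with alt_s[of x] s G show ?thesis by (auto simp: alternate_commute[of _ x])
    next
      case 3
      with s have "x \<noteq> s" "y \<noteq> s" by auto
      with alt_old 3 rep xy show ?thesis by (auto simp: represents_def)
    qed
  qed
  moreover have "count_list ?w x = 2" if "x \<in> set ?w" for x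
    using that cnt[of x] s' uv by (cases "x = s") (auto simp: count_list_0_iff)
  ultimately have "tree_word (relabel_above f r s) ?w ?G"
    using first_occurrences_descend_sandwich[of f u r v s] avoids_132_sandwich[of f u r v s]
      desc av uv s' unfolding tree_word_def by blast
  then show ?thesis by blast
qed

lemma tree_word_singleton: "tree_word (\<lambda>_. 0) [a, a] \<lparr>pverts = {a}, parcs = {}\<rparr>"
  by (auto simp: tree_word_def represents_def first_occurrences_descend_def avoids_132_def
      Cons_eq_append_conv)

lemma representable_132_if_tree_word:
  assumes w: "tree_word f w G" and G: "pair_graph G"
  shows "representable_132 G"
proof -
  have rep: "represents w G" and av: "avoids_132 (map f w)" and inj: "inj_on f (set w)"
    using w inj_on_if_first_occurrences_descend by (auto simp: tree_word_def)
  have setw: "set w = pverts G" using rep by (simp add: represents_def)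
  have injG: "inj_on f (pverts G)" using inj setw by simp
  have "represents (map f w) (relabel f G)"
    unfolding represents_def
  proof (intro conjI ballI impI)
    show "set (map f w) = pverts (relabel f G)" by (simp add: setw relabel_def)
    fix a b assume "a \<in> pverts (relabel f G)" "b \<in> pverts (relabel f G)" "a \<noteq> b"
    then obtain x y where xy: "x \<in> pverts G" "y \<in> pverts G" "a = f x" "b = f y" "x \<noteq> y"
      by (auto simp: relabel_def)
    have "alternate (map f w) a b \<longleftrightarrow> alternate w x y"
      using alternate_map[OF inj, of x y] xy setw by simp
    also have "\<dots> \<longleftrightarrow> (x, y) \<in> parcs G" using rep xy by (simp add: represents_def)
    also have "\<dots> \<longleftrightarrow> (a, b) \<in> parcs (relabel f G)"
      using relabel_arc_iff[OF G injG xy(1,2)] xy by simp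
    finally show "alternate (map f w) a b \<longleftrightarrow> (a, b) \<in> parcs (relabel f G)" .
  qed
  with av injG show ?thesis unfolding representable_132_def by blast
qed

section \<open>Growing a tree vertex by vertex\<close>

context pair_graph
begin

lemma parcs_commute: "(x, y) \<in> parcs G \<longleftrightarrow> (y, x) \<in> parcs G"
  using arcs_symmetric by blast

text \<open>
  The subgraph induced by \<open>S\<close> is connected. Stated with walks of the whole graph, this makes the path
  inside \<open>S\<close> directly available as part of a cycle of the whole graph.
\<close>

definition linked_set :: "'a set \<Rightarrow> bool" where
  "linked_set S \<longleftrightarrow> (\<forall>x \<in> S. \<forall>y \<in> S. \<exists>p. awalk x p y \<and> set p \<subseteq> S \<times> S)"

lemma linked_set_insert:
  assumes S: "linked_set S" and r: "r \<in> S" and rs: "(r, s) \<in> parcs G"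
  shows "linked_set (insert s S)"
proof -
  let ?S = "insert s S"
  have sr: "(s, r) \<in> parcs G" using rs by (simp add: parcs_commute)
  have V: "r \<in> pverts G" "s \<in> pverts G" using arc_fst_in_verts[OF rs] arc_snd_in_verts[OF rs] by auto
  have toR: "\<exists>p. awalk x p r \<and> set p \<subseteq> ?S \<times> ?S" if "x \<in> ?S" for x
  proof (cases "x \<in> S")
    case True
    with S r show ?thesis unfolding linked_set_def by blast
  next
    case False
    with that V sr r have "awalk x [(s, r)] r" by (auto simp: awalk_simps)
    with r show ?thesis by (intro exI[of _ "[(s, r)]"]) auto
  qed
  have fromR: "\<exists>p. awalk r p x \<and> set p \<subseteq> ?S \<times> ?S" if "x \<in> ?S" for x
  proof (cases "x \<in> S")
    case True
    with S r show ?thesis unfolding linked_set_def by blast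
  next
    case False
    with that V rs r have "awalk r [(r, s)] x" by (auto simp: awalk_simps)
    with r show ?thesis by (intro exI[of _ "[(r, s)]"]) auto
  qed
  show ?thesis unfolding linked_set_def
  proof (intro ballI)
    fix x y assume "x \<in> ?S" "y \<in> ?S"
    then obtain p q where "awalk x p r" "awalk r q y" "set p \<subseteq> ?S \<times> ?S" "set q \<subseteq> ?S \<times> ?S"
      using toR fromR by blast
    then show "\<exists>p. awalk x p y \<and> set p \<subseteq> ?S \<times> ?S"
      by (intro exI[of _ "p @ q"]) auto
  qed
qed

text \<open>
  A path inside \<open>S\<close> between two distinct neighbours of \<open>s\<close>, closed up through \<open>s\<close>, is a cycle. It has
  at least one arc besides the two at \<open>s\<close>, hence length at least 3.
\<close>

lemma unique_neighbour_of_linked_set: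
  assumes acyc: "\<not> (\<exists>p. cycle p \<and> 3 \<le> length p)"
    and S: "linked_set S" and s: "s \<notin> S" and r: "r \<in> S" "(r, s) \<in> parcs G"
    and t: "t \<in> S" "(t, s) \<in> parcs G"
  shows "t = r"
proof (rule ccontr)
  assume ne: "t \<noteq> r"
  from S r t obtain q where q: "awalk r q t" "set q \<subseteq> S \<times> S" unfolding linked_set_def by blast
  define p where "p = awalk_to_apath q"
  have p: "awalk r p t" "distinct (pawalk_verts r p)" "set p \<subseteq> S \<times> S"
    using apath_awalk_to_apath[OF q(1)] awalk_to_apath_subset[OF q(1)] q(2)
    by (auto simp: p_def apath_def)
  have pne: "p \<noteq> []" using p(1) ne by (auto simp: awalk_simps)
  have vs: "set (pawalk_verts r p) \<subseteq> S"
    using set_awalk_verts[OF p(1)] p(3) r(1) by auto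
  have sr: "(s, r) \<in> parcs G" using r(2) by (simp add: parcs_commute)
  have pw: "awalk r (p @ [(t, s)]) s"
    using p(1) t arc_snd_in_verts[OF t(2)] by (auto simp: awalk_simps)
  have "awalk s ((s, r) # p @ [(t, s)]) s"
    using pw sr by (simp only: awalk_simps fst_conv snd_conv simp_thms)
  moreover have "pawalk_verts r (p @ [(t, s)]) = pawalk_verts r p @ [s]"
    using awalk_verts_append[OF pw] by simp
  then have "distinct (tl (pawalk_verts s ((s, r) # p @ [(t, s)])))"
    using p(2) vs s by auto
  ultimately have "cycle ((s, r) # p @ [(t, s)])" unfolding cycle_def by blast
  moreover have "3 \<le> length ((s, r) # p @ [(t, s)])" using pne by (cases p) auto
  ultimately show False using acyc by blast
qed

lemma crossing_arc:
  assumes "awalk x p y" "x \<in> S" "y \<notin> S"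
  shows "\<exists>r \<in> S. \<exists>s. s \<notin> S \<and> (r, s) \<in> parcs G"
  using assms
proof (induction p arbitrary: x)
  case Nil
  then show ?case by (auto simp: awalk_simps)
next
  case (Cons e p)
  then have e: "(x, snd e) \<in> parcs G" "awalk (snd e) p y" by (auto simp: awalk_simps)
  show ?case
  proof (cases "snd e \<in> S")
    case True
    with Cons e show ?thesis by blast
  next
    case False
    with Cons.prems e show ?thesis by blast
  qed
qed

end

theorem theorem4p1:
  fixes T :: "'a pair_pre_digraph"
  assumes "undirected_tree T"
  shows "representable_132 T"
proof -
  from assms interpret pair_graph T by (simp add: undirected_tree_def)
  have conn: "Digraph_Component.connected (with_proj T)" and
    acyc: "\<not> (\<exists>p. cycle p \<and> 3 \<le> length p)"
    using assms unfolding undirected_tree_def by blast+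
  define ind where "ind S = \<lparr>pverts = S, parcs = parcs T \<inter> S \<times> S\<rparr>" for S
  define Good where "Good = {S. S \<subseteq> pverts T \<and> S \<noteq> {} \<and> linked_set S \<and> (\<exists>f w. tree_word f w (ind S))}"
  have walk: "\<exists>p. awalk x p y" if "x \<in> pverts T" "y \<in> pverts T" for x y
  proof -
    have "x \<rightarrow>\<^sup>*\<^bsub>with_proj (mk_symmetric (with_proj T))\<^esub> y"
      using conn that
      unfolding Digraph_Component.connected_def strongly_connected_def by simp
    then show ?thesis
      using reachable_mk_symmetric_eq[OF pair_sym_arcs] reachable_awalk by blast
  qed
  have "pverts T \<noteq> {}" using conn
    unfolding Digraph_Component.connected_def strongly_connected_def by simp
  then obtain a where a: "a \<in> pverts T" by blast
  have "parcs (ind {a}) = {}" using pair_no_loops[of "(a, a)"] by (auto simp: ind_def)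
  then have "ind {a} = \<lparr>pverts = {a}, parcs = {}\<rparr>" by (simp add: ind_def)
  moreover have "linked_set {a}"
    unfolding linked_set_def using a by (auto intro!: exI[of _ "[]"] simp: awalk_simps)
  ultimately have "{a} \<in> Good" using a tree_word_singleton[of a] by (auto simp: Good_def)
  moreover have "finite Good"
    by (rule finite_subset[OF _ finite_Pow_iff[THEN iffD2, OF pair_finite_verts]])
      (auto simp: Good_def)
  ultimately obtain S where S: "S \<in> Good" and max: "\<And>S'. S' \<in> Good \<Longrightarrow> S \<subseteq> S' \<Longrightarrow> S' = S"
    using finite_has_maximal[of Good] by blast
  \<comment> \<open>Otherwise an arc leaves \<open>S\<close>, and its head is a leaf that can be added to \<open>S\<close>.\<close>
  have "S = pverts T"
  proof (rule ccontr)
    assume "S \<noteq> pverts T"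
    with S obtain x y where "x \<in> S" "y \<notin> S" "x \<in> pverts T" "y \<in> pverts T"
      by (auto simp: Good_def)
    then obtain r s where rs: "r \<in> S" "s \<notin> S" "(r, s) \<in> parcs T"
      using walk[of x y] crossing_arc[of x _ y S] by blast
    have s: "s \<in> pverts T" using arc_snd_in_verts[OF rs(3)] by simp
    have linked: "linked_set S" using S by (simp add: Good_def)
    have only: "(t, s) \<in> parcs T \<longleftrightarrow> t = r" if "t \<in> S" for t
      using unique_neighbour_of_linked_set[OF acyc linked rs(2,1,3) that] rs(3) by blast
    have ind: "ind (insert s S) =
      \<lparr>pverts = insert s (pverts (ind S)), parcs = parcs (ind S) \<union> {(r, s), (s, r)}\<rparr>"
    proof -
      have "(s, t) \<in> parcs T \<longleftrightarrow> t = r" if "t \<in> S" for t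
        using only[OF that] parcs_commute by blast
      moreover have "(s, s) \<notin> parcs T" using pair_no_loops[of "(s, s)"] by auto
      ultimately show ?thesis using rs(1,2) only by (auto simp: ind_def)
    qed
    have "\<exists>f w. tree_word f w (ind S)" using S by (auto simp: Good_def)
    then have "\<exists>f w. tree_word f w (ind (insert s S))"
      unfolding ind using tree_word_add_leaf[of _ _ "ind S" r s] rs by (auto simp: ind_def)
    then have "insert s S \<in> Good"
      using S s linked_set_insert[OF linked rs(1,3)] by (simp add: Good_def)
    with max rs show False by blast
  qed
  moreover have "ind (pverts T) = T"
  proof -
    have "parcs T \<subseteq> pverts T \<times> pverts T"
      using arc_fst_in_verts arc_snd_in_verts by fastforce
    then show ?thesis by (simp add: ind_def Int_absorb2)
  qed
  ultimately have "\<exists>f w. tree_word f w T" using S by (auto simp: Good_def)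
  then show ?thesis using representable_132_if_tree_word pair_graph_axioms by blast
qed

end
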